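(* For each natural number $m\geqslant 2$, there exist an Abelian group $G$ of cardinality $\aleph_n$, where $n=\frac{m(m+1)}{2}-1$, and a 2-thin subset $A$ of $G$ which cannot be partitioned into $m$ thin subsets of $G$.
   Context: For a group $G$ and $m\in\mathbb{N}=\{1,2,\dots\}$, a subset $A\subseteq G$ is called $m$-thin if for each finite subset $F$ of $G$ there exists a finite subset $K$ of $G$ such that $|Fg\cap A|\leqslant m$ for every $g\in G\setminus K$, where $Fg=\{fg:f\in F\}$ (written $F+g$ in additive notation). A subset is called thin if it is 1-thin. *)

theory Defs
  imports "HOL-Algebra.Coset" "HOL-Library.Disjoint_Sets"
begin

unbundle cardinal_syntax

text \<open>
  \<open>has_card_aleph n X\<close> says that \<open>X\<close> has cardinality \<open>\<aleph>\<^sub>n\<close>.  It is a predicate rather than a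
  cardinal-valued function because \<^const>\<open>cardSuc\<close> raises the type of its argument.
\<close>

primrec has_card_aleph :: "nat \<Rightarrow> 'a set \<Rightarrow> bool" where
  "has_card_aleph 0 X \<longleftrightarrow> |X| =o natLeq"
| "has_card_aleph (Suc n) X \<longleftrightarrow> (\<exists>Y :: 'a set. has_card_aleph n Y \<and> |X| =o cardSuc |Y| )"

text \<open>
  No type contains sets of cardinality \<open>\<aleph>\<^sub>n\<close> for all \<open>n\<close> at once, at least not provably, but for each
  single \<open>n\<close> there is one: \<^typ>\<open>nat\<close> with \<open>set\<close> applied \<open>n\<close> times.
\<close>

lemma has_card_aleph_0_nat: "has_card_aleph 0 (UNIV :: nat set)"
  by (simp add: card_of_nat)

lemma card_of_inj_image:
  assumes "inj f"
  shows "|X| =o |f ` X|"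
  by (rule card_of_ordIsoI[of f]) (use assms inj_on_subset in \<open>auto simp: bij_betw_def\<close>)

lemma has_card_aleph_inj_image:
  fixes X :: "'a set" and f :: "'a \<Rightarrow> 'b"
  assumes "has_card_aleph n X" "inj f"
  shows "has_card_aleph n (f ` X)"
  using assms(1)
proof (induction n arbitrary: X)
  case 0
  then have "|X| =o natLeq" by simp
  with ordIso_symmetric[OF card_of_inj_image[OF assms(2)]] have "|f ` X| =o natLeq"
    by (rule ordIso_transitive)
  then show ?case by simp
next
  case (Suc n)
  then obtain Y :: "'a set" where Y: "has_card_aleph n Y" "|X| =o cardSuc |Y|"
    by auto
  have "cardSuc |Y| =o cardSuc |f ` Y|"
    using cardSuc_invar_ordIso[OF card_of_Card_order card_of_Card_order] card_of_inj_image[OF assms(2)]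
    by (rule iffD2)
  with Y(2) have "|X| =o cardSuc |f ` Y|"
    by (rule ordIso_transitive)
  with ordIso_symmetric[OF card_of_inj_image[OF assms(2)]] have "|f ` X| =o cardSuc |f ` Y|"
    by (rule ordIso_transitive)
  then show ?case
    using Suc.IH[OF Y(1)] by auto
qed

lemma has_card_aleph_Suc_set:
  fixes X :: "'a set"
  assumes "has_card_aleph n X"
  shows "\<exists>Z :: 'a set set. has_card_aleph (Suc n) Z"
proof -
  let ?s = "\<lambda>x :: 'a. {x}"
  have inj: "inj ?s" by simp
  have "cardSuc |X| =o cardSuc |?s ` X|"
    using cardSuc_invar_ordIso[OF card_of_Card_order card_of_Card_order] card_of_inj_image[OF inj]
    by (rule iffD2)
  with card_of_Field_ordIso[OF cardSuc_Card_order[OF card_of_Card_order]]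
  have "|Field (cardSuc |X| )| =o cardSuc |?s ` X|"
    by (rule ordIso_transitive)
  then show ?thesis
    using has_card_aleph_inj_image[OF assms inj] by auto
qed

definition m_thin :: "('a, 'b) monoid_scheme \<Rightarrow> nat \<Rightarrow> 'a set \<Rightarrow> bool" where
  "m_thin G m A \<longleftrightarrow>
     A \<subseteq> carrier G \<and>
     (\<forall>F. finite F \<and> F \<subseteq> carrier G \<longrightarrow>
       (\<exists>K. finite K \<and> K \<subseteq> carrier G \<and>
         (\<forall>g \<in> carrier G - K. card ((F #>\<^bsub>G\<^esub> g) \<inter> A) \<le> m)))"

definition thin :: "('a, 'b) monoid_scheme \<Rightarrow> 'a set \<Rightarrow> bool" where
  "thin G A \<longleftrightarrow> m_thin G 1 A"

text \<open>
  The parts are allowed to be empty.  For infinite \<open>A\<close>, and hence whenever \<open>A\<close> is not thin, this is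
  the same as requiring \<open>m\<close> nonempty parts, since subsets of thin sets are thin.
\<close>

definition partitionable_into_thin :: "('a, 'b) monoid_scheme \<Rightarrow> nat \<Rightarrow> 'a set \<Rightarrow> bool" where
  "partitionable_into_thin G m A \<longleftrightarrow>
     (\<exists>P :: nat \<Rightarrow> 'a set. disjoint_family_on P {..<m} \<and> (\<Union>i<m. P i) = A \<and> (\<forall>i<m. thin G (P i)))"

end

theory Submission
  imports Defs "HOL-Algebra.Weak_Morphisms" "HOL-Algebra.Free_Abelian_Groups"
begin

text \<open>
  The counterexample is a family of complete graphs on \<open>m + 1\<close> vertices.  Such a graph has
  \<open>n + 1 = m (m + 1) / 2\<close> edges \<open>edge 0, \<dots>, edge n\<close>; to \<open>edge k\<close> belongs a set \<open>Y k\<close> of cardinality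
  \<open>\<aleph>\<^sub>k\<close>, and there is one graph for each point \<open>x\<close> of the product \<open>Y 0 \<times> \<dots> \<times> Y n\<close>.  Its vertices
  \<open>vertex 0 x, \<dots>, vertex m x\<close> are elements of the Boolean group of finite subsets of a set of
  generators, and \<open>A\<close> consists of all vertices of all graphs.  Vertex \<open>i\<close> is the sum of a generator
  that names \<open>x\<close> and of generators that name \<open>i\<close>, \<open>k\<close> and the coordinate \<open>x k\<close>, for those \<open>k\<close>
  for which \<open>i\<close> is not an end of \<open>edge k\<close>.  Hence the difference of the vertices \<open>i\<close> and \<open>j\<close> of
  the graph at \<open>x\<close> determines every coordinate of \<open>x\<close> except the one at the edge between \<open>i\<close>
  and \<open>j\<close>, on which it does not depend.

  \<^item> \<open>A\<close> is 2-thin (\<open>two_thin_vertices\<close>).  A difference of vertices of distinct graphs names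
    both graphs.  Two differences within one graph, from vertex \<open>i\<close> to distinct vertices \<open>j\<close> and \<open>k\<close>,
    omit distinct coordinates, so together they determine the graph.

  \<^item> \<open>A\<close> is not a union of \<open>m\<close> thin sets (\<open>not_partitionable_vertices\<close>).  Among the \<open>m + 1\<close>
    vertices of each graph two lie in the same part, which assigns to each point \<open>x\<close> one of the
    \<open>n + 1\<close> coordinate directions.  By a theorem of Kuratowski and Sierpinski (\<open>infinite_line\<close>) some
    line in some direction \<open>q\<close> has infinitely many points that are assigned to \<open>q\<close>.  Along that line the
    difference of the two ends of \<open>edge q\<close> is constant, so some part contains infinitely many
    pairs with the same nonzero difference, and is not thin.

  The group has as many elements as \<open>Y n\<close> and is finally transported to a subset of the given type.
\<close>

section \<open>Thin subsets of groups\<close>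

context group
begin

lemma thin_finite_translates:
  assumes "thin G P" and d: "d \<in> carrier G" "d \<noteq> \<one>"
  shows "finite {a \<in> P. d \<otimes> a \<in> P}"
proof -
  have P: "P \<subseteq> carrier G"
    using assms(1) by (simp add: thin_def m_thin_def)
  have "finite {\<one>, d} \<and> {\<one>, d} \<subseteq> carrier G"
    using d by simp
  then obtain K where K: "finite K" "\<forall>g \<in> carrier G - K. card (({\<one>, d} #> g) \<inter> P) \<le> 1"
    using assms(1) unfolding thin_def m_thin_def by blast
  have "a \<in> K" if a: "a \<in> P" "d \<otimes> a \<in> P" for a
  proof (rule ccontr)
    assume "a \<notin> K"
    have [simp]: "a \<in> carrier G" using P a by blast
    have "d \<otimes> a \<noteq> a" using d by simp
    moreover have "({\<one>, d} #> a) \<inter> P = {a, d \<otimes> a}"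
      using a by (auto simp: r_coset_def)
    ultimately have "card (({\<one>, d} #> a) \<inter> P) = 2" by simp
    moreover have "card (({\<one>, d} #> a) \<inter> P) \<le> 1"
      using K(2) \<open>a \<in> carrier G\<close> \<open>a \<notin> K\<close> by blast
    ultimately show False by simp
  qed
  with K(1) show ?thesis by (blast intro: finite_subset)
qed

text \<open>
  Three elements of a translate of \<open>F\<close> have two distinct nonzero differences, and \<open>F\<close> has only
  finitely many triples.
\<close>
lemma two_thinI:
  assumes A: "A \<subseteq> carrier G"
    and fin: "\<And>d e. \<lbrakk>d \<in> carrier G; e \<in> carrier G; d \<noteq> \<one>; e \<noteq> \<one>; d \<noteq> e\<rbrakk>
      \<Longrightarrow> finite {a \<in> A. d \<otimes> a \<in> A \<and> e \<otimes> a \<in> A}"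
  shows "m_thin G 2 A"
  unfolding m_thin_def
proof (intro conjI allI impI A)
  fix F assume F: "finite F \<and> F \<subseteq> carrier G"
  define B where "B f1 f2 f3 = {g \<in> carrier G. f1 \<otimes> g \<in> A \<and> f2 \<otimes> g \<in> A \<and> f3 \<otimes> g \<in> A}" for f1 f2 f3
  have finB: "finite (B f1 f2 f3)"
    if f: "f1 \<in> F" "f2 \<in> F" "f3 \<in> F" and ne: "f1 \<noteq> f2" "f1 \<noteq> f3" "f2 \<noteq> f3" for f1 f2 f3
  proof -
    have fc [simp]: "f1 \<in> carrier G" "f2 \<in> carrier G" "f3 \<in> carrier G"
      using f F by auto
    let ?d = "f2 \<otimes> inv f1" and ?e = "f3 \<otimes> inv f1"
    have shift: "(f \<otimes> inv f1) \<otimes> (f1 \<otimes> g) = f \<otimes> g" if "f \<in> carrier G" "g \<in> carrier G" for f g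
      using that by (simp add: m_assoc[symmetric]) (simp add: m_assoc)
    have "finite {a \<in> A. ?d \<otimes> a \<in> A \<and> ?e \<otimes> a \<in> A}"
    proof (rule fin)
      show "?d \<noteq> \<one>" "?e \<noteq> \<one>"
        using ne by (metis fc inv_equality inv_inv inv_closed)+
      show "?d \<noteq> ?e"
        using ne by simp
    qed auto
    moreover have "(\<lambda>g. f1 \<otimes> g) ` B f1 f2 f3 \<subseteq> {a \<in> A. ?d \<otimes> a \<in> A \<and> ?e \<otimes> a \<in> A}"
      by (auto simp: B_def shift)
    ultimately have "finite ((\<lambda>g. f1 \<otimes> g) ` B f1 f2 f3)"
      by (rule rev_finite_subset)
    moreover have "inj_on (\<lambda>g. f1 \<otimes> g) (B f1 f2 f3)"
      by (auto simp: inj_on_def B_def)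
    ultimately show ?thesis by (rule finite_imageD)
  qed
  define T where "T = {(f1, f2, f3) \<in> F \<times> F \<times> F. f1 \<noteq> f2 \<and> f1 \<noteq> f3 \<and> f2 \<noteq> f3}"
  define K where "K = (\<Union>(f1, f2, f3) \<in> T. B f1 f2 f3)"
  have "finite T"
    using F by (auto simp: T_def intro: finite_subset[of _ "F \<times> F \<times> F"])
  then have "finite K"
    unfolding K_def by (rule finite_UN_I) (auto simp: T_def finB)
  moreover have "K \<subseteq> carrier G"
    by (auto simp: K_def B_def)
  moreover have "card ((F #> g) \<inter> A) \<le> 2" if g: "g \<in> carrier G - K" for g
  proof (rule ccontr)
    assume "\<not> card ((F #> g) \<inter> A) \<le> 2"
    then have "3 \<le> card ((F #> g) \<inter> A)" by simp
    then obtain S where S: "S \<subseteq> (F #> g) \<inter> A" "card S = 3"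
      by (meson obtain_subset_with_card_n)
    then obtain x y z where xyz: "S = {x, y, z}" "x \<noteq> y" "x \<noteq> z" "y \<noteq> z"
      by (auto simp: card_3_iff)
    obtain f1 f2 f3 where "f1 \<in> F" "f2 \<in> F" "f3 \<in> F" "x = f1 \<otimes> g" "y = f2 \<otimes> g" "z = f3 \<otimes> g"
      using S(1) xyz(1) by (auto simp: r_coset_def)
    with S(1) xyz g have "(f1, f2, f3) \<in> T" "g \<in> B f1 f2 f3"
      by (auto simp: T_def B_def)
    with g show False by (auto simp: K_def)
  qed
  ultimately show "\<exists>K. finite K \<and> K \<subseteq> carrier G \<and> (\<forall>g \<in> carrier G - K. card ((F #> g) \<inter> A) \<le> 2)"
    by blast
qed

lemma m_thin_iso_image:
  assumes "group H" and h: "h \<in> iso G H" and A: "m_thin G k A"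
  shows "m_thin H k (h ` A)"
  unfolding m_thin_def
proof (intro conjI allI impI)
  interpret H: group H by fact
  have inj: "inj_on h (carrier G)" and img: "h ` carrier G = carrier H"
    using h by (auto simp: iso_def bij_betw_def)
  have hom: "h (a \<otimes> b) = h a \<otimes>\<^bsub>H\<^esub> h b" if "a \<in> carrier G" "b \<in> carrier G" for a b
    using h that by (auto simp: iso_def hom_def)
  have AG: "A \<subseteq> carrier G" using A by (simp add: m_thin_def)
  then show "h ` A \<subseteq> carrier H" using img by blast
  fix F assume F: "finite F \<and> F \<subseteq> carrier H"
  then obtain F' where F': "finite F'" "F' \<subseteq> carrier G" "F = h ` F'"
    by (metis img finite_subset_image)
  with A obtain K where K: "finite K" "K \<subseteq> carrier G" "\<forall>g \<in> carrier G - K. card ((F' #> g) \<inter> A) \<le> k"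
    unfolding m_thin_def by blast
  have "card ((F #>\<^bsub>H\<^esub> g) \<inter> h ` A) \<le> k" if g: "g \<in> carrier H - h ` K" for g
  proof -
    obtain g' where g': "g' \<in> carrier G - K" "g = h g'" using g img by blast
    have FG: "F' #> g' \<subseteq> carrier G"
      using F' g' by (auto simp: r_coset_def)
    have "F #>\<^bsub>H\<^esub> g = h ` (F' #> g')"
      using F' g' by (auto simp: r_coset_def hom subset_iff image_iff)
    then have "(F #>\<^bsub>H\<^esub> g) \<inter> h ` A = h ` ((F' #> g') \<inter> A)"
      using inj_on_image_Int[OF inj FG AG] by simp
    moreover have "card (h ` ((F' #> g') \<inter> A)) = card ((F' #> g') \<inter> A)"
      by (rule card_image) (use inj FG in \<open>blast intro: inj_on_subset\<close>)
    ultimately show ?thesis using K(3) g'(1) by simp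
  qed
  moreover have "finite (h ` K)" "h ` K \<subseteq> carrier H"
    using K(1,2) img by auto
  ultimately show "\<exists>K. finite K \<and> K \<subseteq> carrier H \<and> (\<forall>g \<in> carrier H - K. card ((F #>\<^bsub>H\<^esub> g) \<inter> h ` A) \<le> k)"
    by blast
qed

lemma partitionable_into_thin_iso_image:
  assumes "group H" and h: "h \<in> iso G H" and A: "partitionable_into_thin G k A"
  shows "partitionable_into_thin H k (h ` A)"
proof -
  obtain P where P: "disjoint_family_on P {..<k}" "(\<Union>i<k. P i) = A" "\<forall>i<k. thin G (P i)"
    using A unfolding partitionable_into_thin_def by blast
  have inj: "inj_on h (carrier G)" using h by (auto simp: iso_def bij_betw_def)
  have sub: "P i \<subseteq> carrier G" if "i < k" for i
    using P(3) that by (auto simp: thin_def m_thin_def)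
  have "disjoint_family_on (\<lambda>i. h ` P i) {..<k}"
    unfolding disjoint_family_on_def
  proof (intro ballI impI)
    fix i j assume "i \<in> {..<k}" "j \<in> {..<k}" "i \<noteq> j"
    then show "h ` P i \<inter> h ` P j = {}"
      using P(1) inj_on_image_Int[OF inj sub sub, of i j] by (auto simp: disjoint_family_on_def)
  qed
  moreover have "(\<Union>i<k. h ` P i) = h ` A"
    using P(2) by blast
  moreover have "\<forall>i<k. thin H (h ` P i)"
    using P(3) m_thin_iso_image[OF assms(1) h] by (simp add: thin_def)
  ultimately show ?thesis
    unfolding partitionable_into_thin_def by (intro exI[of _ "\<lambda>i. h ` P i"]) simp
qed

end

lemma partitionable_into_thin_iso_imageD:
  assumes "group G" "group H" "h \<in> iso G H" "A \<subseteq> carrier G"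
    and "partitionable_into_thin H k (h ` A)"
  shows "partitionable_into_thin G k A"
proof -
  have "partitionable_into_thin G k (inv_into (carrier G) h ` h ` A)"
    using group.partitionable_into_thin_iso_image[OF assms(2,1) group.iso_set_sym[OF assms(1,3)] assms(5)] .
  moreover have "inv_into (carrier G) h ` h ` A = A"
    using assms(3,4) by (intro inv_into_image_cancel) (auto simp: iso_def bij_betw_def)
  ultimately show ?thesis by simp
qed

section \<open>Products of sets of increasing cardinality\<close>

lemma has_card_aleph_infinite: "has_card_aleph n X \<Longrightarrow> infinite X"
proof (induction n arbitrary: X)
  case 0
  then show ?case
    by (metis has_card_aleph.simps(1) infinite_iff_natLeq_ordLeq ordIso_iff_ordLeq)
next
  case (Suc n)
  then obtain Y :: "'a set" where Y: "has_card_aleph n Y" "|X| =o cardSuc |Y|" by auto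
  have "infinite (Field (cardSuc |Y| ))"
    using Suc.IH[OF Y(1)] cardSuc_finite[OF card_of_Card_order, of Y] by simp
  moreover have "|Field (cardSuc |Y| )| =o |X|"
    using Y(2) by (meson card_of_Card_order card_of_Field_ordIso cardSuc_Card_order ordIso_symmetric ordIso_transitive)
  ultimately show ?case using card_of_ordIso_finite by blast
qed

lemma has_card_aleph_sequence:
  fixes X :: "'a set"
  assumes "has_card_aleph n X"
  shows "\<exists>Y :: nat \<Rightarrow> 'a set. Y n = X \<and> infinite (Y 0) \<and> (\<forall>k<n. |Y k| <o |Y (Suc k)| )"
  using assms
proof (induction n arbitrary: X)
  case 0
  then show ?case by (intro exI[of _ "\<lambda>_. X"]) (use has_card_aleph_infinite in blast)
next
  case (Suc n)
  then obtain Z :: "'a set" where Z: "has_card_aleph n Z" "|X| =o cardSuc |Z|" by auto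
  from Suc.IH[OF Z(1)] obtain Y :: "nat \<Rightarrow> 'a set"
    where Y: "Y n = Z" "infinite (Y 0)" "\<forall>k<n. |Y k| <o |Y (Suc k)|" by blast
  have "|Z| <o |X|"
    using Z(2) by (meson cardSuc_greater card_of_Card_order ordIso_symmetric ordLess_ordIso_trans)
  then show ?case
    using Y by (intro exI[of _ "Y(Suc n := X)"]) (auto simp: less_Suc_eq)
qed

lemma increasing_cardinals:
  assumes "infinite (Y 0)" "\<And>k. k < n \<Longrightarrow> |Y k| <o |Y (Suc k)|" "k \<le> n"
  shows "infinite (Y k) \<and> |Y k| \<le>o |Y n|"
proof -
  have "k \<le> n \<Longrightarrow> |Y k| \<le>o |Y n| \<and> |Y 0| \<le>o |Y k|" for k
    using assms(2)
  proof (induction n arbitrary: k)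
    case 0
    then show ?case by simp
  next
    case (Suc n)
    have lt: "|Y n| <o |Y (Suc n)|" using Suc.prems(2)[of n] by simp
    have IH: "k \<le> n \<Longrightarrow> |Y k| \<le>o |Y n| \<and> |Y 0| \<le>o |Y k|" for k
      using Suc.IH[of k] Suc.prems(2) by simp
    show ?case
      using IH[of k] IH[of n] lt Suc.prems(1) 
      by (metis card_of_mono1 le_Suc_eq order_refl ordLess_imp_ordLeq ordLeq_transitive)
  qed
  with assms(1,3) show ?thesis using card_of_ordLeq_infinite by blast
qed

lemma card_of_PiE_atMost:
  fixes Y :: "nat \<Rightarrow> 'a set"
  assumes "infinite (Y 0)" "\<And>k. k < n \<Longrightarrow> |Y k| <o |Y (Suc k)|"
  shows "|PiE {..n} Y| \<le>o |Y n|"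
  using assms(2)
proof (induction n)
  case 0
  let ?U = "{\<lambda>_. undefined} :: (nat \<Rightarrow> 'a) set"
  have "PiE {..0} Y = (\<lambda>(y, g). g(0 := y)) ` (Y 0 \<times> ?U)"
    by (simp only: atMost_0 PiE_insert_eq PiE_empty_domain)
  also have "|(\<lambda>(y, g). g(0 := y)) ` (Y 0 \<times> ?U)| \<le>o |Y 0 \<times> ?U|"
    by (rule card_of_image)
  also have "|Y 0 \<times> ?U| \<le>o |Y 0|"
    using assms(1)
    by (intro card_of_Sigma_ordLeq_infinite) (auto intro: ordLess_imp_ordLeq finite_ordLess_infinite2)
  finally show ?case .
next
  case (Suc n)
  have inf: "infinite (Y (Suc n))"
    using increasing_cardinals[of Y "Suc n" "Suc n", OF assms(1)] Suc.prems by simp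
  have "|PiE {..n} Y| \<le>o |Y n|" using Suc by simp
  also have "|Y n| \<le>o |Y (Suc n)|"
    using Suc.prems[of n] by (simp add: ordLess_imp_ordLeq)
  finally have IH: "|PiE {..n} Y| \<le>o |Y (Suc n)|" .
  have "PiE {..Suc n} Y = (\<lambda>(y, g). g(Suc n := y)) ` (Y (Suc n) \<times> PiE {..n} Y)"
    by (simp only: atMost_Suc PiE_insert_eq)
  also have "|\<dots>| \<le>o |Y (Suc n) \<times> PiE {..n} Y|"
    by (rule card_of_image)
  also have "|Y (Suc n) \<times> PiE {..n} Y| \<le>o |Y (Suc n)|"
    using inf IH by (intro card_of_Sigma_ordLeq_infinite) auto
  finally show ?case .
qed

text \<open>
  One half of the Kuratowski--Sierpinski theorem, with \<open>R x q\<close> read as \<open>x\<close> being assigned to the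
  direction \<open>q\<close>.  If all lines in the last direction met
  their class in finitely many points only, then fewer than \<open>|Y (Suc n)|\<close> values \<open>t\<close> of the last
  coordinate would occur in these points, since the other coordinates form a set of cardinality \<open>|Y n|\<close>.
  A value \<open>t\<close> that does not occur gives a slice on which the last direction is not used, and the
  induction hypothesis applies to this slice.
\<close>
lemma infinite_line:
  fixes Y :: "nat \<Rightarrow> 'a set"
  assumes "infinite (Y 0)" "\<And>k. k < n \<Longrightarrow> |Y k| <o |Y (Suc k)|"
    and "\<And>x. x \<in> PiE {..n} Y \<Longrightarrow> \<exists>q\<le>n. R x q"
  shows "\<exists>x \<in> PiE {..n} Y. \<exists>q\<le>n. infinite {t \<in> Y q. R (x(q := t)) q}"
  using assms(2,3)
proof (induction n arbitrary: R)
  case 0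
  obtain y where y: "y \<in> Y 0" using assms(1) by fastforce
  define x where "x = (\<lambda>_ :: nat. undefined :: 'a)"
  have x: "x(0 := t) \<in> PiE {..0} Y" if "t \<in> Y 0" for t
    using that by (auto simp: x_def PiE_def extensional_def)
  have "R (x(0 := y, 0 := t)) 0" if "t \<in> Y 0" for t
    using 0(2)[OF x[OF that]] by (metis fun_upd_upd le_zero_eq)
  then have all: "{t \<in> Y 0. R (x(0 := y, 0 := t)) 0} = Y 0" by blast
  have "infinite {t \<in> Y 0. R (x(0 := y, 0 := t)) 0}"
    by (subst all) (rule assms(1))
  with x[OF y] show ?case by blast
next
  case (Suc n)
  show ?case
  proof (rule ccontr)
    assume contra: "\<not> ?thesis"
    have inf: "infinite (Y n)"
      using increasing_cardinals[of Y n n, OF assms(1)] Suc.prems(1) by simp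
    have lt: "|Y n| <o |Y (Suc n)|"
      using Suc.prems(1) by simp
    let ?Z = "PiE {..n} Y"
    let ?B = "\<lambda>z. {t \<in> Y (Suc n). R (z(Suc n := t)) (Suc n)}"
    have ext: "z(Suc n := t) \<in> PiE {..Suc n} Y" if "z \<in> ?Z" "t \<in> Y (Suc n)" for z t
      using that by (simp add: atMost_Suc PiE_fun_upd)
    have "finite (?B z)" if "z \<in> ?Z" for z
    proof (cases "Y (Suc n) = {}")
      case False
      then obtain t where "t \<in> Y (Suc n)" by blast
      then have "finite {s \<in> Y (Suc n). R (z(Suc n := t, Suc n := s)) (Suc n)}"
        using contra ext[OF that] by blast
      then show ?thesis by simp
    qed simp
    then have "\<forall>z\<in>?Z. |?B z| \<le>o |Y n|"
      using inf by (auto intro: ordLess_imp_ordLeq finite_ordLess_infinite2)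
    moreover have "|?Z| \<le>o |Y n|"
      using card_of_PiE_atMost[of Y, OF assms(1)] Suc.prems(1) by simp
    ultimately have "|\<Union>z\<in>?Z. ?B z| \<le>o |Y n|"
      by (rule card_of_UNION_ordLeq_infinite[OF inf, rotated])
    with lt have "|\<Union>z\<in>?Z. ?B z| <o |Y (Suc n)|"
      by (rule ordLeq_ordLess_trans[rotated])
    then have "\<not> Y (Suc n) \<subseteq> (\<Union>z\<in>?Z. ?B z)"
      using card_of_mono1 not_ordLess_ordLeq by blast
    then obtain t where t: "t \<in> Y (Suc n)" "\<And>z. z \<in> ?Z \<Longrightarrow> \<not> R (z(Suc n := t)) (Suc n)"
      by blast
    \<comment> \<open>On the slice at \<open>t\<close> the direction \<open>Suc n\<close> is never used.\<close>
    have "\<exists>x \<in> ?Z. \<exists>q\<le>n. infinite {s \<in> Y q. R (x(q := s, Suc n := t)) q}"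
    proof (rule Suc.IH)
      show "\<And>k. k < n \<Longrightarrow> |Y k| <o |Y (Suc k)|" using Suc.prems(1) by simp
      show "\<exists>q\<le>n. R (x(Suc n := t)) q" if "x \<in> ?Z" for x
        using Suc.prems(2)[OF ext[OF that t(1)]] t(2)[OF that] by (metis le_Suc_eq)
    qed
    then obtain x q where x: "x \<in> ?Z" "q \<le> n" "infinite {s \<in> Y q. R (x(q := s, Suc n := t)) q}"
      by blast
    have "x(q := s, Suc n := t) = x(Suc n := t, q := s)" for s
      using x(2) by (intro fun_upd_twist) simp
    with x(3) have "infinite {s \<in> Y q. R (x(Suc n := t, q := s)) q}"
      by simp
    with contra ext[OF x(1) t(1)] x(2) show False by (meson le_SucI)
  qed
qed

section \<open>The Boolean group of finite sets\<close>

definition finite_subsets_group :: "'g set \<Rightarrow> 'g set monoid" where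
  "finite_subsets_group U = \<lparr>carrier = Fpow U, mult = (\<lambda>A B. sym_diff A B), one = {}\<rparr>"

lemma finite_subsets_group_simps [simp]:
  "carrier (finite_subsets_group U) = Fpow U"
  "A \<otimes>\<^bsub>finite_subsets_group U\<^esub> B = sym_diff A B"
  "\<one>\<^bsub>finite_subsets_group U\<^esub> = {}"
  by (simp_all add: finite_subsets_group_def)

lemma comm_group_finite_subsets_group: "comm_group (finite_subsets_group U)"
proof (rule comm_groupI)
  fix A assume "A \<in> carrier (finite_subsets_group U)"
  then show "\<exists>B \<in> carrier (finite_subsets_group U).
      B \<otimes>\<^bsub>finite_subsets_group U\<^esub> A = \<one>\<^bsub>finite_subsets_group U\<^esub>"
    by (intro bexI[of _ A]) auto
qed (auto simp: Fpow_def)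

text \<open>
  The finite subsets of a set of generators live in a larger type than the one in which the group
  is wanted; a bijection of the carrier moves the structure there.
\<close>
lemma comm_group_on_set:
  assumes "comm_group H" and f: "bij_betw f (carrier H) X"
  shows "\<exists>G :: 'b monoid. comm_group G \<and> carrier G = X \<and> f \<in> iso H G"
proof -
  interpret H: comm_group H by fact
  let ?G = "image_group f H"
  have inj: "inj_on f (carrier H)" using f by (simp add: bij_betw_def)
  have iso: "f \<in> iso H ?G" by (rule inj_imp_image_group_iso[OF inj])
  have "monoid ?G"
    using H.inj_imp_image_group_is_group[OF inj] by (rule group.is_monoid)
  then have "comm_group ?G"
    using iso by (intro H.iso_imp_comm_group) (auto simp: is_iso_def)
  moreover have "carrier ?G = X" using f by (simp add: image_group_carrier bij_betw_def)
  ultimately show ?thesis using iso by blast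
qed

section \<open>Complete graphs over the points of a product\<close>

text \<open>
  \<open>Coord i k t\<close> occurs only in vertices with number \<open>i\<close>; this index prevents the contributions of
  equal coordinates to different vertices of a graph from cancelling.
\<close>
datatype 'a generator = Point "nat \<Rightarrow> 'a" | Coord nat nat 'a

locale labelled_complete_graph =
  fixes m n :: nat and edge :: "nat \<Rightarrow> nat set" and Y :: "nat \<Rightarrow> 'a set"
  assumes m: "2 \<le> m"
    and edge: "bij_betw edge {..n} {e. e \<subseteq> {..m} \<and> card e = 2}"
    and Y0: "infinite (Y 0)"
    and Y_Suc: "\<And>k. k < n \<Longrightarrow> |Y k| <o |Y (Suc k)|"
begin

definition points :: "(nat \<Rightarrow> 'a) set" where
  "points = PiE {..n} Y"

definition gens :: "'a generator set" where
  "gens = Point ` points \<union> (\<lambda>(i, k, t). Coord i k t) ` ({..m} \<times> (SIGMA k:{..n}. Y k))"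

definition vertex :: "nat \<Rightarrow> (nat \<Rightarrow> 'a) \<Rightarrow> 'a generator set" where
  "vertex i x = insert (Point x) {Coord i k (x k) | k. k \<le> n \<and> i \<notin> edge k}"

definition vertices :: "'a generator set set" where
  "vertices = {vertex i x | i x. i \<le> m \<and> x \<in> points}"

lemma mem_vertex [simp]:
  "Point y \<in> vertex i x \<longleftrightarrow> y = x"
  "Coord j k t \<in> vertex i x \<longleftrightarrow> j = i \<and> k \<le> n \<and> i \<notin> edge k \<and> t = x k"
  by (auto simp: vertex_def)

lemma edgeE:
  assumes "i \<le> m" "j \<le> m" "i \<noteq> j"
  obtains q where "q \<le> n" "edge q = {i, j}"
proof -
  have "{i, j} \<in> edge ` {..n}"
    using assms edge by (simp add: bij_betw_def)
  then show thesis using that by force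
qed

lemma edge_memE:
  assumes "q \<le> n"
  obtains i j where "edge q = {i, j}" "i \<le> m" "j \<le> m" "i \<noteq> j"
proof -
  have "edge q \<in> {e. e \<subseteq> {..m} \<and> card e = 2}"
    using assms edge by (auto simp: bij_betw_def)
  then show thesis using that by (auto simp: card_2_iff)
qed

lemma not_mem_edge:
  assumes "q \<le> n" "i \<noteq> j" "i \<noteq> k" "j \<noteq> k"
  shows "i \<notin> edge q \<or> j \<notin> edge q \<or> k \<notin> edge q"
  using edge_memE[OF assms(1)] assms(2-) by (metis insertE singletonD)

lemma gens_card: "|gens| =o |Y n|"
proof -
  have inf: "infinite (Y n)" using increasing_cardinals[of Y n, OF Y0 Y_Suc] by simp
  have fin: "|S| \<le>o |Y n|" if "finite S" for S :: "nat set"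
    using that inf by (auto intro: ordLess_imp_ordLeq finite_ordLess_infinite2)
  have "|points| \<le>o |Y n|"
    unfolding points_def by (rule card_of_PiE_atMost[of Y n, OF Y0 Y_Suc])
  then have 1: "|Point ` points| \<le>o |Y n|"
    using card_of_image ordLeq_transitive by blast
  have "|SIGMA k:{..n}. Y k| \<le>o |Y n|"
    by (rule card_of_Sigma_ordLeq_infinite[OF inf fin])
      (use increasing_cardinals[of Y n, OF Y0 Y_Suc] in auto)
  then have "|{..m} \<times> (SIGMA k:{..n}. Y k)| \<le>o |Y n|"
    by (intro card_of_Sigma_ordLeq_infinite inf fin) auto
  then have 2: "|(\<lambda>(i, k, t). Coord i k t) ` ({..m} \<times> (SIGMA k:{..n}. Y k))| \<le>o |Y n|"
    using card_of_image ordLeq_transitive by blast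
  have "|gens| \<le>o |Y n|"
    unfolding gens_def using inf 1 2
    by (intro card_of_Un_ordLeq_infinite_Field[OF _ _ _ card_of_Card_order, simplified])
  moreover have "|Y n| \<le>o |gens|"
  proof (rule card_of_ordLeqI[of "Coord 0 n"])
    show "inj_on (Coord 0 n) (Y n)" by (simp add: inj_on_def)
    show "Coord 0 n t \<in> gens" if "t \<in> Y n" for t
      using that by (force simp: gens_def)
  qed
  ultimately show ?thesis by (simp add: ordIso_iff_ordLeq)
qed

lemma vertex_in_Fpow:
  assumes "i \<le> m" "x \<in> points"
  shows "vertex i x \<in> Fpow gens"
proof -
  have "finite {Coord i k (x k) | k. k \<le> n \<and> i \<notin> edge k}"
    by (rule finite_subset[of _ "(\<lambda>k. Coord i k (x k)) ` {..n}"]) auto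
  moreover have "x k \<in> Y k" if "k \<le> n" for k
    using assms(2) that by (auto simp: points_def)
  ultimately show ?thesis
    using assms by (force simp: Fpow_def vertex_def gens_def)
qed

lemma sym_diff_vertices_coord:
  assumes "i \<noteq> j" "q \<le> n" "i \<notin> edge q \<or> j \<notin> edge q"
  shows "\<exists>p. Coord p q (x q) \<in> sym_diff (vertex i x) (vertex j x)"
  using assms by auto

text \<open>
  With a third vertex \<open>k\<close> there is an edge that ends in \<open>j\<close> but not in \<open>i\<close>; this is where \<open>m \<ge> 2\<close>
  enters.  For \<open>m = 1\<close> the two vertices of a graph coincide.
\<close>
lemma vertex_neq:
  assumes "i \<le> m" "j \<le> m" "i \<noteq> j"
  shows "vertex i x \<noteq> vertex j y"
proof -
  have "\<exists>k\<le>m. k \<noteq> i \<and> k \<noteq> j"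
  proof -
    have "card {i, j} < card {..m}" using m assms by simp
    then have "\<not> {..m} \<subseteq> {i, j}" by (meson card_mono finite.emptyI finite.insertI leD)
    then show ?thesis by blast
  qed
  then obtain k where "k \<le> m" "k \<noteq> i" "k \<noteq> j" by blast
  then obtain q where "q \<le> n" "edge q = {j, k}" using edgeE assms(2) by metis
  then have "Coord i q (x q) \<in> vertex i x" "Coord i q (x q) \<notin> vertex j y"
    using assms \<open>k \<noteq> i\<close> by auto
  then show ?thesis by blast
qed

text \<open>
  Neither end of \<open>edge q\<close> involves the coordinate \<open>q\<close>, and the generator \<open>Point\<close> cancels.  This is why
  all points of a line in direction \<open>q\<close> yield the same difference.
\<close>
lemma sym_diff_vertex_upd:
  assumes "q \<le> n" "edge q = {i, j}"
  shows "sym_diff (vertex i (x(q := t))) (vertex j (x(q := t))) = sym_diff (vertex i x) (vertex j x)"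
  using assms by (auto simp: vertex_def)

lemma two_thin_vertices: "m_thin (finite_subsets_group gens) 2 vertices"
proof -
  let ?H = "finite_subsets_group gens"
  interpret comm_group ?H by (rule comm_group_finite_subsets_group)
  show ?thesis
  proof (rule two_thinI)
    show "vertices \<subseteq> carrier ?H"
      by (auto simp: vertices_def vertex_in_Fpow)
    fix d e assume "d \<in> carrier ?H" "e \<in> carrier ?H"
      and ne: "d \<noteq> \<one>\<^bsub>?H\<^esub>" "e \<noteq> \<one>\<^bsub>?H\<^esub>" "d \<noteq> e"
    then have fin: "finite (d \<union> e)" by (simp add: Fpow_def)
    \<comment> \<open>the points of the graphs that can be read off from the supports of \<open>d\<close> and \<open>e\<close>\<close>
    define S where "S = {x. Point x \<in> d \<union> e} \<union> PiE {..n} (\<lambda>q. {t. \<exists>p. Coord p q t \<in> d \<union> e})"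
    have "finite {x. Point x \<in> d \<union> e}"
      using finite_vimageI[OF fin, of Point] by (simp add: inj_def vimage_def)
    moreover have "finite {t. \<exists>p. Coord p q t \<in> d \<union> e}" for q
    proof (rule finite_subset)
      show "{t. \<exists>p. Coord p q t \<in> d \<union> e} \<subseteq> (\<lambda>g. case g of Coord p q t \<Rightarrow> t | Point x \<Rightarrow> x 0) ` (d \<union> e)"
        by (force simp: image_iff)
    qed (use fin in simp)
    ultimately have finS: "finite S"
      by (auto simp: S_def intro: finite_PiE)
    have "a \<in> (\<lambda>(i, x). vertex i x) ` ({..m} \<times> S)"
      if a: "a \<in> vertices" "sym_diff d a \<in> vertices" "sym_diff e a \<in> vertices" for a
    proof -
      obtain i x where i: "i \<le> m" "x \<in> points" "a = vertex i x"
        using a(1) by (auto simp: vertices_def)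
      obtain j y where j: "sym_diff d a = vertex j y"
        using a(2) by (auto simp: vertices_def)
      obtain k z where k: "sym_diff e a = vertex k z"
        using a(3) by (auto simp: vertices_def)
      have d: "d = sym_diff (vertex i x) (vertex j y)" and e: "e = sym_diff (vertex i x) (vertex k z)"
        using i(3) j k by blast+
      have "x \<in> S"
      proof (cases "y = x \<and> z = x")
        case False
        then show ?thesis by (auto simp: S_def d e)
      next
        case True
        \<comment> \<open>All three vertices lie in the graph at \<open>x\<close>, and no edge contains all of them.\<close>
        have "i \<noteq> j" "i \<noteq> k" "j \<noteq> k"
          using ne True d e by auto
        then have "\<exists>p. Coord p q (x q) \<in> d \<union> e" if "q \<le> n" for q
          using not_mem_edge[OF that, of i j k] sym_diff_vertices_coord[of i j q x]
            sym_diff_vertices_coord[of i k q x] that True d e by blast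
        then show ?thesis
          using i(2) by (simp add: S_def points_def PiE_iff)
      qed
      with i show ?thesis by force
    qed
    then have "{a \<in> vertices. sym_diff d a \<in> vertices \<and> sym_diff e a \<in> vertices}
        \<subseteq> (\<lambda>(i, x). vertex i x) ` ({..m} \<times> S)" by blast
    moreover have "finite ((\<lambda>(i, x). vertex i x) ` ({..m} \<times> S))"
      using finS by simp
    ultimately have "finite {a \<in> vertices. sym_diff d a \<in> vertices \<and> sym_diff e a \<in> vertices}"
      by (rule finite_subset)
    then show "finite {a \<in> vertices. d \<otimes>\<^bsub>?H\<^esub> a \<in> vertices \<and> e \<otimes>\<^bsub>?H\<^esub> a \<in> vertices}"
      by (simp only: finite_subsets_group_simps)
  qed
qed

lemma not_partitionable_vertices: "\<not> partitionable_into_thin (finite_subsets_group gens) m vertices"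
proof
  let ?H = "finite_subsets_group gens"
  interpret comm_group ?H by (rule comm_group_finite_subsets_group)
  assume "partitionable_into_thin ?H m vertices"
  then obtain P where P: "(\<Union>r<m. P r) = vertices" "\<And>r. r < m \<Longrightarrow> thin ?H (P r)"
    unfolding partitionable_into_thin_def by blast
  define R where "R x q \<longleftrightarrow> (\<exists>r<m. \<forall>i\<in>edge q. vertex i x \<in> P r)" for x q
  have "\<exists>q\<le>n. R x q" if x: "x \<in> points" for x
  proof -
    have "\<forall>i\<in>{..m}. \<exists>r. r < m \<and> vertex i x \<in> P r"
      using P(1) x by (force simp: vertices_def)
    then obtain c where c: "\<And>i. i \<le> m \<Longrightarrow> c i < m \<and> vertex i x \<in> P (c i)"
      by (metis atMost_iff)
    then have "c ` {..m} \<subseteq> {..<m}" by auto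
    then have "card (c ` {..m}) \<le> m"
      by (metis card_lessThan card_mono finite_lessThan)
    then have "\<not> inj_on c {..m}"
      by (intro pigeonhole) simp
    then obtain i j where ij: "i \<le> m" "j \<le> m" "i \<noteq> j" "c i = c j"
      by (auto simp: inj_on_def)
    then obtain q where "q \<le> n" "edge q = {i, j}" by (meson edgeE)
    then have "R x q"
      unfolding R_def using c[OF ij(1)] c[OF ij(2)] ij(4) by (intro exI[of _ "c i"]) auto
    with \<open>q \<le> n\<close> show ?thesis by blast
  qed
  then obtain x q where x: "x \<in> points" and q: "q \<le> n" and inf: "infinite {t \<in> Y q. R (x(q := t)) q}"
    using infinite_line[of Y n R, OF Y0 Y_Suc] unfolding points_def by blast
  obtain i j where ij: "edge q = {i, j}" "i \<le> m" "j \<le> m" "i \<noteq> j"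
    using edge_memE[OF q] .
  let ?v = "\<lambda>i t. vertex i (x(q := t))"
  have "\<exists>r\<in>{..<m}. infinite {t \<in> {t \<in> Y q. R (x(q := t)) q}. ?v i t \<in> P r \<and> ?v j t \<in> P r}"
    by (rule pigeonhole_infinite_rel[OF inf]) (auto simp: R_def ij)
  then obtain r T where r: "r < m" and T: "infinite T" "\<And>t. t \<in> T \<Longrightarrow> ?v i t \<in> P r \<and> ?v j t \<in> P r"
    by (metis (mono_tags, lifting) lessThan_iff mem_Collect_eq)
  let ?d = "sym_diff (vertex i x) (vertex j x)"
  have "?d \<in> carrier ?H"
    using vertex_in_Fpow[OF _ x] ij by (simp add: Fpow_def) blast
  moreover have "?d \<noteq> \<one>\<^bsub>?H\<^esub>"
    using vertex_neq[OF ij(2-4), of x x] by auto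
  ultimately have "finite {a \<in> P r. ?d \<otimes>\<^bsub>?H\<^esub> a \<in> P r}"
    by (rule thin_finite_translates[OF P(2)[OF r]])
  moreover have "(\<lambda>t. ?v i t) ` T \<subseteq> {a \<in> P r. ?d \<otimes>\<^bsub>?H\<^esub> a \<in> P r}"
  proof (rule image_subsetI)
    fix t assume t: "t \<in> T"
    have "sym_diff ?d (?v i t) = ?v j t"
      using sym_diff_vertex_upd[OF q ij(1), of x t] by blast
    then show "?v i t \<in> {a \<in> P r. ?d \<otimes>\<^bsub>?H\<^esub> a \<in> P r}"
      using T(2)[OF t] by simp
  qed
  ultimately have "finite ((\<lambda>t. ?v i t) ` T)" by (rule rev_finite_subset)
  moreover have "inj_on (\<lambda>t. ?v i t) T"
  proof (rule inj_onI)
    fix s t assume "?v i s = ?v i t"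
    then have "x(q := s) = x(q := t)" by (metis mem_vertex(1))
    then show "s = t" by (metis fun_upd_same)
  qed
  ultimately show False using T(1) finite_imageD by blast
qed

end

theorem mainTheorem3:
  fixes m :: nat
  assumes "2 \<le> m"
    and "\<exists>X :: 'a set. has_card_aleph (m * (m + 1) div 2 - 1) X"
  shows "\<exists>(G :: 'a monoid) A.
           comm_group G \<and> has_card_aleph (m * (m + 1) div 2 - 1) (carrier G) \<and>
           m_thin G 2 A \<and> \<not> partitionable_into_thin G m A"
proof -
  define n where "n = m * (m + 1) div 2 - 1"
  obtain X :: "'a set" where X: "has_card_aleph n X"
    using assms(2) by (auto simp: n_def)
  obtain Y :: "nat \<Rightarrow> 'a set"
    where Y: "Y n = X" "infinite (Y 0)" "\<And>k. k < n \<Longrightarrow> |Y k| <o |Y (Suc k)|"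
    using has_card_aleph_sequence[OF X] by blast
  have "2 * 3 \<le> m * (m + 1)" using assms(1) by (intro mult_le_mono) auto
  then have "card {..n} = m * (m + 1) div 2" by (simp add: n_def)
  also have "\<dots> = card {e. e \<subseteq> {..m} \<and> card e = 2}"
    by (simp add: n_subsets choose_two mult.commute)
  finally have "\<exists>edge. bij_betw edge {..n} {e. e \<subseteq> {..m} \<and> card e = 2}"
    by (intro finite_same_card_bij) auto
  then obtain edge where edge: "bij_betw edge {..n} {e. e \<subseteq> {..m} \<and> card e = 2}" ..
  interpret labelled_complete_graph m n edge Y
    using assms(1) edge Y by unfold_locales auto
  let ?H = "finite_subsets_group gens"
  have H: "comm_group ?H" by (rule comm_group_finite_subsets_group)
  have "|gens| =o |X|" using gens_card Y(1) by simp
  moreover have "infinite gens"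
    using calculation has_card_aleph_infinite[OF X] card_of_ordIso_finite by blast
  ultimately have "|Fpow gens| =o |X|"
    using card_of_Fpow_infinite ordIso_transitive by blast
  then obtain f where f: "bij_betw f (carrier ?H) X"
    by (auto simp: card_of_ordIso[symmetric])
  obtain G :: "'a monoid" where G: "comm_group G" "carrier G = X" "f \<in> iso ?H G"
    using comm_group_on_set[OF H f] by blast
  have grp: "group ?H" "group G" using H G(1) by (auto simp: comm_group.axioms(2))
  have "m_thin G 2 (f ` vertices)"
    using group.m_thin_iso_image[OF grp G(3) two_thin_vertices] .
  moreover have "\<not> partitionable_into_thin G m (f ` vertices)"
    using partitionable_into_thin_iso_imageD[OF grp G(3)] not_partitionable_vertices
      two_thin_vertices by (auto simp: m_thin_def)
  ultimately show ?thesis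
    using G X unfolding n_def[symmetric] by blast
qed

end
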